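(* Let $(X,b)$ be a connected graph that satisfies a global variation norm Poincaré inequality, i.e. there is $c\ge0$ such that $$\|f\|_{\mathcal V}^2\le c\,\mathcal{E}(f)\qquad\text{for all } f\in\mathcal{D}. \tag{GVPI}$$ Then the best possible (i.e. smallest) constant $C_P$ in (GVPI) satisfies $$\frac{4}{C_P}=\inf\bigl\{\lambda_1^N(X,b,m)\ \bigm|\ m\in\mathcal{P}(X),\ \mathrm{supp}(m)=X\bigr\}.$$
   Context: A graph $(X,b)$ consists of an arbitrary set $X$ and a symmetric function $b:X\times X\to[0,\infty)$ with $b(x,x)=0$ for all $x\in X$ (no local finiteness or summability of $b$ is assumed). It is connected if for any $x,y\in X$ there is a finite sequence $x=x_0,\dots,x_k=y$ in $X$ with $b(x_l,x_{l+1})>0$ for $l=0,\dots,k-1$. The energy is $\mathcal{E}(f)=\frac12\sum_{x,y\in X}b(x,y)(f(x)-f(y))^2\in[0,\infty]$ for $f:X\to\mathbb{R}$, and $\mathcal{D}=\{f:X\to\mathbb{R}\mid\mathcal{E}(f)<\infty\}$. The variation seminorm is $\|f\|_{\mathcal V}=\sup f-\inf f$ (with value $\infty$ if $f$ is unbounded). $\mathcal{P}(X)$ is the set of all probability measures on $X$, where a measure is given by a function $m:X\to[0,1]$ with $\sum_{x\in X} m(x)=1$; $\mathrm{supp}(m)=X$ means $m(x)>0$ for all $x\in X$. For such $m$ with $\mathrm{supp}(m)=X$, let $\ell^2(X,m)=\{f:X\to\mathbb{R}\mid\sum_x f(x)^2m(x)<\infty\}$ with inner product $\langle f,g\rangle=\sum_x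 f(x)g(x)m(x)$ and norm $\|f\|=\sqrt{\langle f,f\rangle}$, and let $$\lambda_1^N(X,b,m)=\inf\{\mathcal{E}(f)\mid f\in\ell^2(X,m),\ \mathcal{E}(f)<\infty,\ \langle f,1\rangle=0,\ \|f\|=1\}.$$ This is the first non-zero eigenvalue of the Neumann Laplacian $H(X,b,m)$, the self-adjoint operator associated with $\mathcal{E}$ on its maximal domain in $\ell^2(X,m)$. The usual conventions $\inf\emptyset=\infty$ and $4/0=\infty$ are used.
   Formalization: X is assumed countable: for uncountable X no probability measure has full support, so the right-hand side is inf ∅ = ∞, and the identity fails, e.g. for a star with uncountably many leaves of weight 1, where C_P = 2. *)

theory Defs
  imports "HOL-Analysis.Analysis"
begin

text \<open>The vertex set \<open>X\<close> is the universe of the type \<open>'a\<close>. Every sum is an unordered sum in the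
  sense of \<open>infsum\<close>, so no summability of \<open>b\<close> is needed. Quantities in \<open>[0, \<infinity>]\<close> are \<open>ereal\<close>s: there,
  the infimum of the empty set is \<open>\<infinity>\<close> and \<open>4 / 0 = \<infinity>\<close>.\<close>

definition graph :: "('a \<Rightarrow> 'a \<Rightarrow> real) \<Rightarrow> bool" where
  "graph b \<longleftrightarrow> (\<forall>x y. 0 \<le> b x y) \<and> (\<forall>x y. b x y = b y x) \<and> (\<forall>x. b x x = 0)"

definition connected_graph :: "('a \<Rightarrow> 'a \<Rightarrow> real) \<Rightarrow> bool" where
  "connected_graph b \<longleftrightarrow> graph b \<and> (\<forall>x y. (\<lambda>u v. b u v > 0)\<^sup>*\<^sup>* x y)"

definition energy :: "('a \<Rightarrow> 'a \<Rightarrow> real) \<Rightarrow> ('a \<Rightarrow> real) \<Rightarrow> ereal" where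
  "energy b f = (1 / 2) * (\<Sum>\<^sub>\<infinity>(x, y)\<in>UNIV. ereal (b x y * (f x - f y)\<^sup>2))"

definition finite_energy :: "('a \<Rightarrow> 'a \<Rightarrow> real) \<Rightarrow> ('a \<Rightarrow> real) set" where
  "finite_energy b = {f. energy b f < \<infinity>}"

text \<open>The value is \<open>\<infinity>\<close> for unbounded \<open>f\<close>; the case \<open>\<infinity> - (- \<infinity>) = \<infinity>\<close> is included.\<close>
definition variation :: "('a \<Rightarrow> real) \<Rightarrow> ereal" where
  "variation f = (SUP x. ereal (f x)) - (INF x. ereal (f x))"

definition prob_measures :: "('a \<Rightarrow> real) set" where
  "prob_measures = {m. (\<forall>x. 0 \<le> m x \<and> m x \<le> 1) \<and> (m has_sum 1) UNIV}"

definition supp :: "('a \<Rightarrow> real) \<Rightarrow> 'a set" where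
  "supp m = {x. m x > 0}"

definition ell2 :: "('a \<Rightarrow> real) \<Rightarrow> ('a \<Rightarrow> real) set" where
  "ell2 m = {f. (\<lambda>x. (f x)\<^sup>2 * m x) summable_on UNIV}"

definition ell2_inner :: "('a \<Rightarrow> real) \<Rightarrow> ('a \<Rightarrow> real) \<Rightarrow> ('a \<Rightarrow> real) \<Rightarrow> real" where
  "ell2_inner m f g = (\<Sum>\<^sub>\<infinity>x\<in>UNIV. f x * g x * m x)"

definition ell2_norm :: "('a \<Rightarrow> real) \<Rightarrow> ('a \<Rightarrow> real) \<Rightarrow> real" where
  "ell2_norm m f = sqrt (ell2_inner m f f)"

definition neumann_lambda1 :: "('a \<Rightarrow> 'a \<Rightarrow> real) \<Rightarrow> ('a \<Rightarrow> real) \<Rightarrow> ereal" where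
  "neumann_lambda1 b m =
     Inf {energy b f | f. f \<in> ell2 m \<and> energy b f < \<infinity> \<and>
                          ell2_inner m f (\<lambda>_. 1) = 0 \<and> ell2_norm m f = 1}"

definition gvpi :: "('a \<Rightarrow> 'a \<Rightarrow> real) \<Rightarrow> real \<Rightarrow> bool" where
  "gvpi b c \<longleftrightarrow> 0 \<le> c \<and> (\<forall>f\<in>finite_energy b. (variation f)\<^sup>2 \<le> ereal c * energy b f)"

definition smallest_gvpi_const :: "('a \<Rightarrow> 'a \<Rightarrow> real) \<Rightarrow> real \<Rightarrow> bool" where
  "smallest_gvpi_const b C \<longleftrightarrow> gvpi b C \<and> (\<forall>c. gvpi b c \<longrightarrow> C \<le> c)"

end

theory Submission
  imports Defs
begin

text \<open>
  The identity splits into two inequalities between the optimal constant \<open>C\<close> and the infimum \<open>L\<close>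
  of the numbers \<open>\<lambda>\<^sub>1(m)\<close>. Both compare the variance of a function with the square of its
  oscillation.

  Lower bound, \<open>4 / C \<le> L\<close>: A test function for \<open>\<lambda>\<^sub>1(m)\<close> has mean \<open>0\<close> and variance \<open>1\<close> with
  respect to \<open>m\<close>. Popoviciu's inequality says that the variance of a function with values in an
  interval of length \<open>r\<close> is at most \<open>r\<^sup>2 / 4\<close> (\<open>popoviciu\<close>). Hence a test function has squared
  variation at least \<open>4\<close>, and the Poincare inequality gives it energy at least \<open>4 / C\<close>.

  Upper bound, \<open>L \<le> 4 / C\<close>: Equality in Popoviciu's inequality occurs when the mass sits in equal
  halves at two points where the function attains its extreme values. Full support usually excludes
  this, but on a countable set there is a measure of full support with mass arbitrarily close to
  \<open>1 / 2\<close> at each of two prescribed points \<open>x\<close> and \<open>y\<close> (\<open>two_point_measure_exists\<close>). The variance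
  of \<open>f\<close> is then at least a number arbitrarily close to \<open>(f x - f y)\<^sup>2 / 4\<close>, and normalising \<open>f\<close> to
  a test function shows that \<open>L (f x - f y)\<^sup>2 / 4\<close> is at most the energy of \<open>f\<close>
  (\<open>neumann_lambda1_le\<close>). As \<open>x\<close> and \<open>y\<close> are arbitrary, this is the Poincare inequality with
  constant \<open>4 / L\<close>.
\<close>

section \<open>Energy and variation\<close>

lemma energy_nonneg:
  assumes "graph b"
  shows "0 \<le> energy b f"
proof -
  have "(0::ereal) \<le> (\<Sum>\<^sub>\<infinity>(x, y)\<in>UNIV. ereal (b x y * (f x - f y)\<^sup>2))"
    using assms by (intro infsum_nonneg) (auto simp: graph_def)
  then show ?thesis
    by (simp add: energy_def)
qed

lemma finite_energyE:
  assumes "graph b" "f \<in> finite_energy b"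
  obtains e where "energy b f = ereal e" "0 \<le> e"
  using assms energy_nonneg[OF assms(1), of f]
  by (cases "energy b f") (auto simp: finite_energy_def)

text \<open>The sum of extended reals is the supremum of the finite partial sums, from which the constant
  factor can be pulled out even when the sum is infinite.\<close>

lemma energy_affine:
  assumes "graph b"
  shows "energy b (\<lambda>x. k * (f x - a)) = ereal (k\<^sup>2) * energy b f"
proof -
  define g where "g = (\<lambda>(x, y). ereal (b x y * (f x - f y)\<^sup>2))"
  have g_nonneg: "0 \<le> g p" for p
    using assms by (auto simp: g_def graph_def split: prod.split)
  let ?Fin = "{F. finite F \<and> F \<subseteq> (UNIV :: ('a \<times> 'a) set)}"
  have scaled: "(\<lambda>(x, y). ereal (b x y * (k * (f x - a) - k * (f y - a))\<^sup>2)) = (\<lambda>p. ereal (k\<^sup>2) * g p)"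
  proof -
    have "(k * (f x - a) - k * (f y - a))\<^sup>2 = k\<^sup>2 * (f x - f y)\<^sup>2" for x y
      by (simp flip: right_diff_distrib power_mult_distrib)
    then show ?thesis
      by (simp add: g_def fun_eq_iff mult.left_commute)
  qed
  have "infsum (\<lambda>p. ereal (k\<^sup>2) * g p) UNIV = (SUP F\<in>?Fin. \<Sum>p\<in>F. ereal (k\<^sup>2) * g p)"
    by (rule nonneg_infsum_complete) (auto simp: g_nonneg)
  also have "\<dots> = (SUP F\<in>?Fin. ereal (k\<^sup>2) * sum g F)"
    by (intro SUP_cong refl) (simp add: sum_ereal_right_distrib g_nonneg)
  also have "\<dots> = ereal (k\<^sup>2) * (SUP F\<in>?Fin. sum g F)"
    by (rule SUP_ereal_mult_left) (auto simp: g_nonneg sum_nonneg)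
  also have "(SUP F\<in>?Fin. sum g F) = infsum g UNIV"
    by (rule nonneg_infsum_complete[symmetric]) (auto simp: g_nonneg)
  finally show ?thesis
    unfolding energy_def scaled g_def[symmetric] by (simp add: mult.left_commute)
qed

text \<open>A pointwise form of the bound on the variation. It keeps the extended reals, and in
  particular the case of unbounded functions, out of all later arguments.\<close>

lemma variation_square_le_iff:
  assumes "0 \<le> K"
  shows "(variation f)\<^sup>2 \<le> ereal K \<longleftrightarrow> (\<forall>x y. (f x - f y)\<^sup>2 \<le> K)"
proof
  assume le: "(variation f)\<^sup>2 \<le> ereal K"
  have "(f x - f y)\<^sup>2 \<le> K" if "f y \<le> f x" for x y
  proof -
    have osc: "ereal (f x) - ereal (f y) \<le> variation f"
      unfolding variation_def by (intro ereal_minus_mono SUP_upper INF_lower) auto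
    have "ereal ((f x - f y)\<^sup>2) \<le> (variation f)\<^sup>2"
      using ereal_mult_mono'[OF _ _ osc osc] that by (simp add: power2_eq_square)
    then show ?thesis
      using le by (metis ereal_less_eq(3) order_trans)
  qed
  then show "\<forall>x y. (f x - f y)\<^sup>2 \<le> K"
    by (metis linear power2_commute)
next
  assume osc: "\<forall>x y. (f x - f y)\<^sup>2 \<le> K"
  define r where "r = sqrt K"
  have r: "0 \<le> r" "r\<^sup>2 = K"
    using assms by (auto simp: r_def)
  have close: "f x \<le> f y + r" for x y
    using osc[rule_format, of x y] real_le_rsqrt[of "f x - f y" K] by (simp add: r_def)
  define s where "s = (SUP x. f x)"
  define i where "i = (INF x. f x)"
  have bdd: "bdd_above (range f)" "bdd_below (range f)"
  proof -
    show "bdd_above (range f)"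
      using close[of _ undefined] by (intro bdd_aboveI2)
    show "bdd_below (range f)"
      using close[of undefined] by (intro bdd_belowI2[where m = "f undefined - r"]) (simp add: algebra_simps)
  qed
  have "i \<le> s"
    unfolding i_def s_def by (meson bdd cINF_lower cSUP_upper UNIV_I order_trans)
  have "s \<le> f y + r" for y
    unfolding s_def by (intro cSUP_least) (auto simp: close)
  then have "s - r \<le> i"
    unfolding i_def by (intro cINF_greatest) (auto simp: algebra_simps)
  have "variation f \<le> ereal s - ereal i"
    unfolding variation_def
    by (intro ereal_minus_mono SUP_least INF_greatest) (auto simp: s_def i_def bdd cSUP_upper cINF_lower)
  moreover have "0 \<le> variation f"
  proof -
    have "ereal (f undefined) - ereal (f undefined) \<le> variation f"
      unfolding variation_def by (intro ereal_minus_mono SUP_upper INF_lower) auto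
    then show ?thesis by simp
  qed
  ultimately have "(variation f)\<^sup>2 \<le> (ereal (s - i))\<^sup>2"
    unfolding power2_eq_square by (intro ereal_mult_mono') auto
  moreover have "(s - i)\<^sup>2 \<le> K"
    using \<open>s - r \<le> i\<close> \<open>i \<le> s\<close> r power_mono[of "s - i" r 2] by simp
  ultimately show "(variation f)\<^sup>2 \<le> ereal K"
    by (metis ereal_less_eq(3) ereal_power order_trans)
qed

lemma gvpi_iff:
  assumes "graph b"
  shows "gvpi b c \<longleftrightarrow>
    0 \<le> c \<and> (\<forall>f e. energy b f = ereal e \<longrightarrow> (\<forall>x y. (f x - f y)\<^sup>2 \<le> c * e))"
proof (cases "0 \<le> c")
  case True
  have "(\<forall>f\<in>finite_energy b. (variation f)\<^sup>2 \<le> ereal c * energy b f) \<longleftrightarrow>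
        (\<forall>f e. energy b f = ereal e \<longrightarrow> (variation f)\<^sup>2 \<le> ereal (c * e))"
    by (metis (lifting) assms finite_energyE finite_energy_def less_ereal.simps(4) mem_Collect_eq times_ereal.simps(1))
  moreover have "(variation f)\<^sup>2 \<le> ereal (c * e) \<longleftrightarrow> (\<forall>x y. (f x - f y)\<^sup>2 \<le> c * e)"
    if "energy b f = ereal e" for f e
    using energy_nonneg[OF assms, of f] that True by (intro variation_square_le_iff) simp
  ultimately show ?thesis
    using True by (simp add: gvpi_def)
qed (simp add: gvpi_def)

lemma smallest_gvpi_const_exists:
  assumes "graph b" "\<exists>c. gvpi b c"
  shows "\<exists>C. smallest_gvpi_const b C"
proof -
  define S where "S = {c. gvpi b c}"
  have S: "S \<noteq> {}" "bdd_below S"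
    using assms(2) by (auto simp: S_def gvpi_def bdd_below_def)
  have "0 \<le> Inf S"
    using S(1) by (intro cInf_greatest) (auto simp: S_def gvpi_def)
  moreover have "(f x - f y)\<^sup>2 \<le> Inf S * e" if e: "energy b f = ereal e" for f e x y
  proof -
    have bound: "(f x - f y)\<^sup>2 \<le> c * e" if "c \<in> S" for c
      using that e gvpi_iff[OF assms(1)] by (simp add: S_def)
    have "0 \<le> e"
      using energy_nonneg[OF assms(1), of f] e by simp
    then consider "e = 0" | "0 < e" by linarith
    then show ?thesis
    proof cases
      case 1
      then show ?thesis using S(1) bound by auto
    next
      case 2
      have "(f x - f y)\<^sup>2 / e \<le> Inf S"
        using S(1) bound 2 by (intro cInf_greatest) (auto simp: pos_divide_le_eq)
      then show ?thesis
        using 2 by (simp add: pos_divide_le_eq)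
    qed
  qed
  ultimately have "gvpi b (Inf S)"
    using gvpi_iff[OF assms(1)] by blast
  then show ?thesis
    using S(2) by (auto simp: smallest_gvpi_const_def S_def intro!: exI[of _ "Inf S"] cInf_lower)
qed

section \<open>Variance and the spectral gap\<close>

lemma bounded_mult_prob_summable:
  fixes f :: "'a \<Rightarrow> real"
  assumes "m \<in> prob_measures" and "\<And>x. \<bar>f x\<bar> \<le> B"
  shows "(\<lambda>x. f x * m x) summable_on UNIV"
proof -
  have "(\<lambda>x. B * m x) summable_on UNIV"
    using assms(1)
    by (intro summable_on_cmult_right has_sum_imp_summable[where S = 1]) (simp add: prob_measures_def)
  moreover have "norm (f x * m x) \<le> B * m x" for x
    using mult_right_mono[OF assms(2), of "m x"] assms(1)
    by (simp add: prob_measures_def abs_mult)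
  ultimately have "(\<lambda>x. norm (f x * m x)) summable_on UNIV"
    by (rule summable_on_comparison_test) (rule norm_ge_zero)
  then show ?thesis
    by (rule abs_summable_summable)
qed

text \<open>Integrating \<open>(f - a) (a + r - f) \<ge> 0\<close>, where \<open>f\<close> takes values in \<open>[a, a + r]\<close>, bounds the
  second moment of a centred function by \<open>- a (a + r)\<close>, which is at most \<open>r\<^sup>2 / 4\<close>.\<close>

lemma popoviciu:
  fixes f :: "'a \<Rightarrow> real"
  assumes m: "m \<in> prob_measures"
    and osc: "\<And>x y. (f x - f y)\<^sup>2 \<le> K"
    and mean: "((\<lambda>x. f x * m x) has_sum 0) UNIV"
    and second: "((\<lambda>x. (f x)\<^sup>2 * m x) has_sum V) UNIV"
  shows "4 * V \<le> K"
proof -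
  have "0 \<le> K"
    using osc[of undefined undefined] by simp
  define r where "r = sqrt K"
  have close: "f x - f y \<le> r" for x y
    using osc[of x y] real_le_rsqrt[of "f x - f y" K] by (simp add: r_def)
  define a where "a = (INF x. f x)"
  have "bdd_below (range f)"
    using close[of undefined] by (intro bdd_belowI2[where m = "f undefined - r"]) (simp add: algebra_simps)
  then have lower: "a \<le> f x" for x
    unfolding a_def by (intro cINF_lower) auto
  have "f x - r \<le> a" for x
    unfolding a_def using close[of x] by (intro cINF_greatest) (auto simp: algebra_simps)
  then have "0 \<le> ((f x - a) * (a + r - f x)) * m x" for x
    using lower[of x] m by (intro mult_nonneg_nonneg) (auto simp: prob_measures_def algebra_simps)
  moreover have "((\<lambda>x. (2 * a + r) * (f x * m x) + (- 1) * ((f x)\<^sup>2 * m x) + (- a * (a + r)) * m x)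
      has_sum ((2 * a + r) * 0 + (- 1) * V + (- a * (a + r)) * 1)) UNIV"
    using m by (intro has_sum_add has_sum_cmult_right mean second) (auto simp: prob_measures_def)
  moreover have "(\<lambda>x. (2 * a + r) * (f x * m x) + (- 1) * ((f x)\<^sup>2 * m x) + (- a * (a + r)) * m x)
      = (\<lambda>x. ((f x - a) * (a + r - f x)) * m x)"
    by (auto simp: fun_eq_iff power2_eq_square algebra_simps)
  ultimately have "0 \<le> (2 * a + r) * 0 + (- 1) * V + (- a * (a + r)) * 1"
    by (metis (no_types, lifting) has_sum_nonneg)
  moreover have "4 * (- a * (a + r)) = r\<^sup>2 - (2 * a + r)\<^sup>2"
    by (simp add: power2_eq_square algebra_simps)
  moreover have "r\<^sup>2 = K"
    using \<open>0 \<le> K\<close> by (simp add: r_def)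
  moreover have "0 \<le> (2 * a + r)\<^sup>2"
    by simp
  ultimately show ?thesis
    by linarith
qed

lemma neumann_lambda1_ge:
  assumes "graph b" "gvpi b C" "m \<in> prob_measures"
  shows "4 / ereal C \<le> neumann_lambda1 b m"
  unfolding neumann_lambda1_def
proof (rule Inf_greatest, clarify)
  fix f
  assume f: "f \<in> ell2 m" "energy b f < \<infinity>" "ell2_inner m f (\<lambda>_. 1) = 0" "ell2_norm m f = 1"
  obtain e where e: "energy b f = ereal e" "0 \<le> e"
    using finite_energyE[OF assms(1), of f] f(2) by (auto simp: finite_energy_def)
  have osc: "(f x - f y)\<^sup>2 \<le> C * e" for x y
    using assms gvpi_iff e by blast
  have "0 \<le> C"
    using assms(2) by (simp add: gvpi_def)
  have "((\<lambda>x. (f x)\<^sup>2 * m x) has_sum 1) UNIV"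
    using f(1,4) has_sum_infsum[of "\<lambda>x. (f x)\<^sup>2 * m x" UNIV]
    by (simp add: ell2_def ell2_norm_def ell2_inner_def power2_eq_square)
  moreover have "((\<lambda>x. f x * m x) has_sum 0) UNIV"
  proof -
    \<comment> \<open>A function with finite energy is bounded, so its mean is an honest sum and not the default
      value of a divergent one.\<close>
    have "\<bar>f x\<bar> \<le> \<bar>f undefined\<bar> + sqrt (C * e)" for x
      using real_sqrt_le_mono[OF osc[of x undefined]] by simp
    then show ?thesis
      using has_sum_infsum[OF bounded_mult_prob_summable[OF assms(3)]] f(3)
      by (metis (no_types, lifting) ell2_inner_def infsum_cong mult.right_neutral)
  qed
  ultimately have "4 * 1 \<le> C * e"
    using popoviciu[OF assms(3)] osc by blast
  moreover from this have "0 < C"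
    using \<open>0 \<le> C\<close> by (cases "C = 0") auto
  ultimately show "4 / ereal C \<le> energy b f"
    by (simp add: e(1) pos_divide_le_eq mult.commute)
qed

text \<open>The two points \<open>x\<close> and \<open>y\<close> alone contribute at least \<open>t (f x - f y)\<^sup>2 / 2\<close> to the variance
  of \<open>f\<close>, whatever its mean is. The normalised function is a test function for the infimum.\<close>

lemma neumann_lambda1_le:
  assumes "graph b" and m: "m \<in> prob_measures"
    and bounded: "\<And>z. \<bar>f z\<bar> \<le> B"
    and e: "energy b f = ereal e"
    and "f x \<noteq> f y" "0 < t" "t \<le> m x" "t \<le> m y"
  shows "neumann_lambda1 b m \<le> ereal (2 * e / (t * (f x - f y)\<^sup>2))"
proof -
  have "0 \<le> e"
    using energy_nonneg[OF assms(1), of f] e by simp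
  have "0 \<le> B"
    using bounded[of undefined] by linarith
  have nonneg: "0 \<le> m z" and total: "(m has_sum 1) UNIV" for z
    using m by (auto simp: prob_measures_def)
  define \<mu> where "\<mu> = (\<Sum>\<^sub>\<infinity>z. f z * m z)"
  define V where "V = (\<Sum>\<^sub>\<infinity>z. (f z - \<mu>)\<^sup>2 * m z)"
  have mean: "((\<lambda>z. f z * m z) has_sum \<mu>) UNIV"
    unfolding \<mu>_def by (intro has_sum_infsum bounded_mult_prob_summable[OF m bounded])
  have "\<bar>(f z - \<mu>)\<^sup>2\<bar> \<le> (B + \<bar>\<mu>\<bar>)\<^sup>2" for z
  proof -
    have "\<bar>f z - \<mu>\<bar> \<le> \<bar>B + \<bar>\<mu>\<bar>\<bar>"
      using bounded[of z] by linarith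
    then show ?thesis
      using abs_le_square_iff[of "f z - \<mu>" "B + \<bar>\<mu>\<bar>"] by simp
  qed
  then have variance: "((\<lambda>z. (f z - \<mu>)\<^sup>2 * m z) has_sum V) UNIV"
    unfolding V_def by (intro has_sum_infsum bounded_mult_prob_summable[OF m])
  have "(f x - f y)\<^sup>2 + (f x + f y - 2 * \<mu>)\<^sup>2 = 2 * ((f x - \<mu>)\<^sup>2 + (f y - \<mu>)\<^sup>2)"
    by (simp add: power2_eq_square algebra_simps)
  then have "(f x - f y)\<^sup>2 \<le> 2 * ((f x - \<mu>)\<^sup>2 + (f y - \<mu>)\<^sup>2)"
    by (metis le_add_same_cancel1 zero_le_power2)
  then have "t * (f x - f y)\<^sup>2 \<le> t * (2 * ((f x - \<mu>)\<^sup>2 + (f y - \<mu>)\<^sup>2))"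
    using \<open>0 < t\<close> by (intro mult_left_mono) auto
  then have "t * (f x - f y)\<^sup>2 / 2 \<le> t * ((f x - \<mu>)\<^sup>2 + (f y - \<mu>)\<^sup>2)"
    by (subst pos_divide_le_eq) (simp_all only: zero_less_numeral mult.commute mult.left_commute)
  also have "\<dots> \<le> (\<Sum>z\<in>{x, y}. (f z - \<mu>)\<^sup>2 * m z)"
  proof -
    have "x \<noteq> y" using \<open>f x \<noteq> f y\<close> by auto
    moreover have "t * (f x - \<mu>)\<^sup>2 \<le> (f x - \<mu>)\<^sup>2 * m x" "t * (f y - \<mu>)\<^sup>2 \<le> (f y - \<mu>)\<^sup>2 * m y"
      using \<open>t \<le> m x\<close> \<open>t \<le> m y\<close> by (simp_all add: mult.commute[of t] mult_left_mono)
    ultimately show ?thesis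
      by (simp add: distrib_left)
  qed
  also have "\<dots> \<le> V"
    by (rule has_sum_mono'[OF has_sum_finite variance]) (auto simp: nonneg)
  finally have V_ge: "t * (f x - f y)\<^sup>2 / 2 \<le> V" .
  moreover have t_pos: "0 < t * (f x - f y)\<^sup>2"
    using \<open>f x \<noteq> f y\<close> \<open>0 < t\<close> by simp
  ultimately have "0 < V"
    by linarith
  define k where "k = 1 / sqrt V"
  have k: "k\<^sup>2 = 1 / V"
    using \<open>0 < V\<close> by (simp add: k_def power_divide)
  define g where "g = (\<lambda>z. k * (f z - \<mu>))"
  have "((\<lambda>z. k * (f z * m z) + (- k * \<mu>) * m z) has_sum (k * \<mu> + (- k * \<mu>) * 1)) UNIV"
    by (intro has_sum_add has_sum_cmult_right mean total)
  then have "((\<lambda>z. g z * 1 * m z) has_sum 0) UNIV"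
    by (simp add: g_def algebra_simps)
  then have centred: "ell2_inner m g (\<lambda>_. 1) = 0"
    unfolding ell2_inner_def by (rule infsumI)
  have "((\<lambda>z. k\<^sup>2 * ((f z - \<mu>)\<^sup>2 * m z)) has_sum (k\<^sup>2 * V)) UNIV"
    by (intro has_sum_cmult_right variance)
  then have g2: "((\<lambda>z. (g z)\<^sup>2 * m z) has_sum 1) UNIV"
    using \<open>0 < V\<close> by (simp add: k g_def power_mult_distrib mult.assoc)
  then have "g \<in> ell2 m" and "ell2_norm m g = 1"
    using infsumI[OF g2]
    by (auto simp: ell2_def summable_on_def ell2_norm_def ell2_inner_def power2_eq_square)
  moreover have energy: "energy b g = ereal (e / V)"
    unfolding g_def energy_affine[OF assms(1)] by (simp add: e k)
  ultimately have "neumann_lambda1 b m \<le> ereal (e / V)"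
    unfolding neumann_lambda1_def using centred
    by (intro Inf_lower CollectI exI[of _ g]) auto
  also have "e / V \<le> e / (t * (f x - f y)\<^sup>2 / 2)"
    using V_ge t_pos \<open>0 \<le> e\<close> by (intro divide_left_mono) auto
  then have "ereal (e / V) \<le> ereal (2 * e / (t * (f x - f y)\<^sup>2))"
    by (simp add: mult.commute)
  finally show ?thesis .
qed

section \<open>Measures of full support concentrated at two points\<close>

lemma full_support_measure_exists:
  assumes "countable (UNIV :: 'a set)"
  shows "\<exists>m :: 'a \<Rightarrow> real. m \<in> prob_measures \<and> supp m = UNIV"
proof -
  define w :: "'a \<Rightarrow> real" where "w x = (1 / 2) ^ to_nat_on UNIV x" for x
  have "(\<lambda>n. (1 / 2 :: real) ^ n) summable_on UNIV"
    by (intro norm_summable_imp_summable_on) (simp add: summable_geometric)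
  then have "(\<lambda>n. (1 / 2 :: real) ^ n) summable_on range (to_nat_on (UNIV :: 'a set))"
    by (rule summable_on_subset_banach) simp
  then have sum: "w summable_on UNIV"
    by (subst (asm) summable_on_reindex) (auto simp: assms inj_on_to_nat_on o_def w_def[abs_def])
  define W where "W = infsum w UNIV"
  have W: "(w has_sum W) UNIV"
    unfolding W_def by (rule has_sum_infsum[OF sum])
  have w: "0 < w x" for x
    by (simp add: w_def)
  have le: "w x \<le> W" for x
    using has_sum_mono'[OF has_sum_finite[of "{x}" w] W] by (simp add: less_imp_le[OF w])
  have "0 < W"
    using w le less_le_trans by blast
  have "((\<lambda>x. (1 / W) * w x) has_sum ((1 / W) * W)) UNIV"
    by (rule has_sum_cmult_right[OF W])
  then have "(\<lambda>x. w x / W) \<in> prob_measures" "supp (\<lambda>x. w x / W) = UNIV"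
    using \<open>0 < W\<close> w le less_imp_le[OF w] by (auto simp: prob_measures_def supp_def)
  then show ?thesis by blast
qed

text \<open>The measure is a convex combination of a measure with full support and the uniform
  distribution on \<open>{x, y}\<close>.\<close>

lemma two_point_measure_exists:
  fixes x y :: 'a
  assumes "countable (UNIV :: 'a set)" "x \<noteq> y" "0 \<le> t" "t < 1 / 2"
  shows "\<exists>m. m \<in> prob_measures \<and> supp m = UNIV \<and> t \<le> m x \<and> t \<le> m y"
proof -
  obtain m0 :: "'a \<Rightarrow> real" where m0: "m0 \<in> prob_measures" "supp m0 = UNIV"
    using full_support_measure_exists[OF assms(1)] by blast
  have m0_range: "0 < m0 z" "m0 z \<le> 1" and m0_total: "(m0 has_sum 1) UNIV" for z
    using m0 by (auto simp: prob_measures_def supp_def)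
  define m where "m = (\<lambda>z. (1 - 2 * t) * m0 z + t * of_bool (z \<in> {x, y}))"
  have "((\<lambda>z. of_bool (z \<in> {x, y}) :: real) has_sum 2) UNIV"
    using assms(2) by (intro has_sum_finite_neutralI[of "{x, y}"]) auto
  then have "(m has_sum ((1 - 2 * t) * 1 + t * 2)) UNIV"
    unfolding m_def by (intro has_sum_add has_sum_cmult_right m0_total)
  then have total: "(m has_sum 1) UNIV" by simp
  have pos: "0 < m z" for z
    using m0_range[of z] assms(3,4) by (auto simp: m_def intro!: add_pos_nonneg)
  have "m z \<le> 1" for z
    using has_sum_mono'[OF has_sum_finite[of "{z}" m] total] by (simp add: less_imp_le[OF pos])
  moreover have "t \<le> m x" "t \<le> m y"
    using less_imp_le[OF m0_range(1)] assms(4) by (simp_all add: m_def)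
  ultimately show ?thesis
    using total pos less_imp_le[OF pos] by (intro exI[of _ m]) (auto simp: prob_measures_def supp_def)
qed

section \<open>The optimal constant\<close>

theorem theorem5p2:
  fixes b :: "'a \<Rightarrow> 'a \<Rightarrow> real"
  assumes "countable (UNIV :: 'a set)"
    and "connected_graph b"
    and "\<exists>c. gvpi b c"
  shows "\<exists>C\<^sub>P. smallest_gvpi_const b C\<^sub>P \<and>
           4 / ereal C\<^sub>P = Inf {neumann_lambda1 b m | m. m \<in> prob_measures \<and> supp m = UNIV}"
proof -
  have graph: "graph b"
    using assms(2) by (simp add: connected_graph_def)
  obtain C where C: "smallest_gvpi_const b C"
    using smallest_gvpi_const_exists[OF graph assms(3)] by blast
  then have gvpi: "gvpi b C" and least: "\<And>c. gvpi b c \<Longrightarrow> C \<le> c"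
    by (auto simp: smallest_gvpi_const_def)
  then have "0 \<le> C"
    by (simp add: gvpi_def)
  define L where "L = Inf {neumann_lambda1 b m | m. m \<in> prob_measures \<and> supp m = UNIV}"
  have ge: "4 / ereal C \<le> L"
    unfolding L_def using neumann_lambda1_ge[OF graph gvpi] by (intro Inf_greatest) blast
  have two_point: "L \<le> ereal (4 * e / (f x - f y)\<^sup>2)"
    if e: "energy b f = ereal e" and neq: "f x \<noteq> f y" for f e x y
  proof -
    have "(f z - f undefined)\<^sup>2 \<le> C * e" for z
      using gvpi gvpi_iff[OF graph] e by blast
    then have bounded: "\<bar>f z\<bar> \<le> \<bar>f undefined\<bar> + sqrt (C * e)" for z
      using real_sqrt_le_mono[of "(f z - f undefined)\<^sup>2" "C * e"] by simp
    have bound: "L \<le> ereal (2 * e / (t * (f x - f y)\<^sup>2))" if t: "0 < t" "t < 1 / 2" for t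
    proof -
      obtain m where m: "m \<in> prob_measures" "supp m = UNIV" "t \<le> m x" "t \<le> m y"
        using two_point_measure_exists[OF assms(1), of x y t] t neq by fastforce
      have "L \<le> neumann_lambda1 b m"
        unfolding L_def using m by (intro Inf_lower) auto
      also have "\<dots> \<le> ereal (2 * e / (t * (f x - f y)\<^sup>2))"
        by (rule neumann_lambda1_le[OF graph m(1) bounded e neq t(1) m(3,4)])
      finally show ?thesis .
    qed
    have "((\<lambda>t. ereal (2 * e / (t * (f x - f y)\<^sup>2))) \<longlongrightarrow> ereal (2 * e / (1 / 2 * (f x - f y)\<^sup>2)))
        (at_left (1 / 2))"
      using neq by (intro tendsto_intros lim_ereal[THEN iffD2]) auto
    moreover have "\<forall>\<^sub>F t in at_left (1 / 2). L \<le> ereal (2 * e / (t * (f x - f y)\<^sup>2))"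
      by (rule eventually_mono[OF eventually_at_left_real[of 0 "1 / 2"]]) (auto intro: bound)
    ultimately have "L \<le> ereal (2 * e / (1 / 2 * (f x - f y)\<^sup>2))"
      by (intro tendsto_lowerbound) auto
    then show ?thesis by simp
  qed
  have "L \<le> 4 / ereal C"
  proof (cases L)
    case PInf
    \<comment> \<open>All functions of finite energy are constant, as happens for a single vertex.\<close>
    have "(f x - f y)\<^sup>2 \<le> 0 * e" if "energy b f = ereal e" for f e x y
      using two_point[OF that, of x y] PInf by (cases "f x = f y") auto
    then have "gvpi b 0"
      by (simp add: gvpi_iff[OF graph])
    then have "C = 0"
      using least \<open>0 \<le> C\<close> by force
    then show ?thesis by simp
  next
    case MInf
    then show ?thesis by simp
  next
    case (real l)
    have "0 < C"
      using ge real \<open>0 \<le> C\<close> by (cases "C = 0") auto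
    then have "4 / C \<le> l"
      using ge real by simp
    then have "0 < l"
      using \<open>0 < C\<close> by (meson divide_pos_pos less_le_trans zero_less_numeral)
    have "(f x - f y)\<^sup>2 \<le> 4 / l * e" if e: "energy b f = ereal e" for f e x y
    proof (cases "f x = f y")
      case True
      then show ?thesis
        using energy_nonneg[OF graph, of f] e \<open>0 < l\<close> by simp
    next
      case False
      then have "l \<le> 4 * e / (f x - f y)\<^sup>2"
        using two_point[OF e False] real by simp
      then show ?thesis
        using False \<open>0 < l\<close> by (simp add: field_simps)
    qed
    then have "gvpi b (4 / l)"
      using \<open>0 < l\<close> by (simp add: gvpi_iff[OF graph])
    then have "C \<le> 4 / l"
      by (rule least)
    then show ?thesis
      using \<open>0 < C\<close> \<open>0 < l\<close> real by (simp add: field_simps)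
  qed
  then show ?thesis
    using C ge unfolding L_def by (intro exI[of _ C]) auto
qed

end
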